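(* Let $\mathcal{G}=(G_n)_{n\ge1}$ be an $\mathrm{Inc}$-invariant chain of graphs with stability index $r=\mathrm{ind}(\mathcal{G})$ and sparsity index $\mathrm{sp}(\mathcal{G})=s$. Assume that $V(G_r)=[r]$ and that $(1,i),(j,r)\in E(G_r)$ for some $i,j\in[r]$. Let $\gamma(G_n)$ and $\omega(G_n)$ denote the chromatic number and the clique number of $G_n$. Then there exists $n_0$ such that $$\gamma(G_n)=\gamma(G_{n_0})+\left\lfloor\frac{n-n_0}{s}\right\rfloor\quad\text{for all }n\ge n_0.$$ Furthermore, $$\omega(G_n)\le\gamma(G_n)\le\omega(G_n)+1\quad\text{for all sufficiently large }n.$$
   Context: $\mathbb{N}$ is the set of positive integers and $[n]=\{1,\dots,n\}$. Graphs are simple and finite, with vertex set contained in $\mathbb{N}$ (possibly empty); an edge $\{i,j\}$ with $i<j$ is written $(i,j)$. $G\subseteq H$ means $V(G)\subseteq V(H)$ and $E(G)\subseteq E(H)$. $\mathrm{Inc}$ is the monoid of strictly increasing maps $\pi:\mathbb{N}\to\mathbb{N}$, and $\mathrm{Inc}_{n,m}=\{\pi\in\mathrm{Inc}\mid\pi(n)\le m\}$ for $n\le m$. For $\Gamma\subseteq\mathrm{Inc}$ and a graph $G$, $\Gamma(G)$ is the graph with vertex set $\bigcup_{\pi\in\Gamma}\pi(V(G))$ and edge set $\{(\pi(i),\pi(j))\mid \pi\in\Gamma,(i,j)\in E(G)\}$. An $\mathrm{Inc}$-invariant chain of graphs is a sequence $(G_n)_{n\ge1}$ of graphs with $V(G_n)\subseteq[n]$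 and $\mathrm{Inc}_{n,m}(G_n)\subseteq G_m$ for all $m\ge n\ge1$. Every such chain stabilizes: there is $r\in\mathbb{N}$ with $\mathrm{Inc}_{n,m}(G_n)=G_m$ for all $m\ge n\ge r$; the smallest such $r$ is the stability index $\mathrm{ind}(\mathcal{G})$. The sparsity index is $\mathrm{sp}(\mathcal{G})=\min\{j-i\mid(i,j)\in E(G_r)\}$, where $r=\mathrm{ind}(\mathcal{G})$. *)

theory Defs
  imports Complex_Main
begin

text \<open>
  The paper's set of positive integers is rendered as the subset \<open>{1..}\<close> of type \<open>nat\<close>.
  An edge is stored as the pair \<open>(i, j)\<close> of its end points with \<open>i < j\<close>, so each
  undirected edge has exactly one representation and loops are excluded.
\<close>

record graph =
  verts :: "nat set"
  edges :: "(nat \<times> nat) set"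

definition is_graph :: "graph \<Rightarrow> bool" where
  "is_graph H \<longleftrightarrow> finite (verts H) \<and> verts H \<subseteq> {1..} \<and>
     (\<forall>(i, j) \<in> edges H. i \<in> verts H \<and> j \<in> verts H \<and> i < j)"

definition subgraph :: "graph \<Rightarrow> graph \<Rightarrow> bool" where
  "subgraph H K \<longleftrightarrow> verts H \<subseteq> verts K \<and> edges H \<subseteq> edges K"

definition chromatic_number :: "graph \<Rightarrow> nat" where
  "chromatic_number H =
     (LEAST k. \<exists>c :: nat \<Rightarrow> nat. c ` verts H \<subseteq> {1..k} \<and> (\<forall>(i, j) \<in> edges H. c i \<noteq> c j))"

definition is_clique :: "graph \<Rightarrow> nat set \<Rightarrow> bool" where
  "is_clique H C \<longleftrightarrow> C \<subseteq> verts H \<and> (\<forall>i\<in>C. \<forall>j\<in>C. i < j \<longrightarrow> (i, j) \<in> edges H)"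

definition clique_number :: "graph \<Rightarrow> nat" where
  "clique_number H = Max {card C | C. is_clique H C}"

text \<open>
  Elements of \<open>Inc\<close> are maps on the positive integers; their value at \<open>0\<close> is unconstrained
  and is never used, since graphs have positive vertices.
\<close>

definition Inc :: "(nat \<Rightarrow> nat) set" where
  "Inc = {\<pi>. strict_mono_on {1..} \<pi> \<and> \<pi> ` {1..} \<subseteq> {1..}}"

definition Inc_le :: "nat \<Rightarrow> nat \<Rightarrow> (nat \<Rightarrow> nat) set" where
  "Inc_le n m = {\<pi> \<in> Inc. \<pi> n \<le> m}"

definition map_graph :: "(nat \<Rightarrow> nat) set \<Rightarrow> graph \<Rightarrow> graph" where
  "map_graph \<Gamma> H =
     \<lparr> verts = (\<Union>\<pi>\<in>\<Gamma>. \<pi> ` verts H),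
       edges = {(\<pi> i, \<pi> j) | \<pi> i j. \<pi> \<in> \<Gamma> \<and> (i, j) \<in> edges H} \<rparr>"

text \<open>Chains are indexed by the positive integers; the entry at index \<open>0\<close> is irrelevant.\<close>

definition inc_invariant_chain :: "(nat \<Rightarrow> graph) \<Rightarrow> bool" where
  "inc_invariant_chain G \<longleftrightarrow>
     (\<forall>n\<ge>1. is_graph (G n) \<and> verts (G n) \<subseteq> {1..n}) \<and>
     (\<forall>n\<ge>1. \<forall>m\<ge>n. subgraph (map_graph (Inc_le n m) (G n)) (G m))"

definition stability_index :: "(nat \<Rightarrow> graph) \<Rightarrow> nat" where
  "stability_index G =
     (LEAST r. 1 \<le> r \<and> (\<forall>n\<ge>r. \<forall>m\<ge>n. map_graph (Inc_le n m) (G n) = G m))"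

definition sparsity_index :: "(nat \<Rightarrow> graph) \<Rightarrow> nat" where
  "sparsity_index G = Min {j - i | i j. (i, j) \<in> edges (G (stability_index G))}"

end

theory Submission
  imports Defs
begin

text \<open>
  An increasing map with \<open>\<pi> r \<le> n\<close> can move a pair \<open>i < j \<le> r\<close> to \<open>x < y\<close> exactly if none of the
  three distances to the left end, between the points, and to the right end shrinks
  (\<open>pair_orbit_iff\<close>). The edges of a chain thus form an up-set of \<open>\<nat>\<^sup>3\<close>; likewise the vertices, with
  only the distances to the two ends, form an up-set of \<open>\<nat>\<^sup>2\<close>. Dickson's lemma gives stabilization
  (\<open>inc_invariant_chain_stabilizes\<close>), and for \<open>n \<ge> r\<close> the graph \<open>G\<^sub>n\<close> is given explicitly by the edges
  of \<open>G\<^sub>r\<close> (locale \<open>stable_edges\<close>). Three consequences matter. Every edge has length at least \<open>s\<close>, so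
  a set of vertices of diameter less than \<open>s\<close> is independent. Away from the two ends, vertices at
  distance at least \<open>s\<close> are adjacent. And, by the edges at \<open>1\<close> and at \<open>r\<close>, a vertex far from both
  ends is adjacent to every vertex at distance at least \<open>r\<close>.

  \<^bold>\<open>The chromatic number.\<close> A colour class that meets the central zone therefore has diameter less
  than \<open>s\<close>. Replacing the classes of this kind greedily, from the left, by windows of \<open>s\<close> consecutive
  integers costs no colour and produces a central cut \<open>u\<close> that no class crosses, apart from classes
  avoiding the central zone (\<open>colouring_cut\<close>). At \<open>u\<close> one can insert \<open>s\<close> new vertices forming a new
  class, or delete the window of \<open>s\<close> vertices that starts there together with a class. Adjacency
  between vertices near the ends does not notice the change of \<open>n\<close>, so
  \<open>\<gamma>(G\<^bsub>n+s\<^esub>) = \<gamma>(G\<^sub>n) + 1\<close> (\<open>chromatic_number_add_s\<close>). Since \<open>\<gamma>(G\<^sub>n)\<close> is nondecreasing, it jumps by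
  one exactly once in every period of length \<open>s\<close>, and taking \<open>n\<^sub>0\<close> at a jump gives the formula.

  \<^bold>\<open>The clique number.\<close> Adjacency from smaller to larger vertices is transitive on either side of a
  central cut \<open>u\<close>, so each side has a Mirsky colouring: colour a vertex by the largest clique of its
  side in which it is extremal. For an edge across \<open>u\<close>, two such cliques form a single clique
  after one vertex next to the cut is dropped. Hence, numbering the colours on the left downwards
  and those on the right upwards, the two colourings fit together with one colour more
  than the clique number (\<open>chromatic_number_le_Suc_clique_number\<close>).
\<close>

section \<open>Orbits of pairs under increasing maps\<close>

lemma Inc_gap:
  assumes "\<pi> \<in> Inc" "1 \<le> i" "i \<le> j"
  shows "j + \<pi> i \<le> \<pi> j + i"
  using assms(3)
proof (induction j rule: dec_induct)
  case base
  then show ?case by simp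
next
  case (step k)
  have "\<pi> k < \<pi> (Suc k)"
    using assms(1,2) step(1) by (auto simp: Inc_def strict_mono_on_def)
  then show ?case using step by simp
qed

lemma Inc_ge:
  assumes "\<pi> \<in> Inc" "1 \<le> i"
  shows "i \<le> \<pi> i"
proof -
  have "1 \<le> \<pi> 1" using assms(1) by (auto simp: Inc_def)
  then show ?thesis using Inc_gap[OF assms(1) order_refl assms(2)] by simp
qed

text \<open>
  The inequalities say that the distances \<open>i\<close>, \<open>j - i\<close> and \<open>n - j\<close> do not shrink. They are written
  additively here and below because subtraction on \<^typ>\<open>nat\<close> truncates.
\<close>

lemma pair_orbit_iff:
  assumes "1 \<le> i" "i < j" "j \<le> n"
  shows "(\<exists>\<pi>\<in>Inc_le n m. \<pi> i = x \<and> \<pi> j = y) \<longleftrightarrow> i \<le> x \<and> j + x \<le> y + i \<and> y + n \<le> m + j"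
    (is "?L \<longleftrightarrow> ?R")
proof
  assume ?L
  then obtain \<pi> where \<pi>: "\<pi> \<in> Inc" "\<pi> n \<le> m" "\<pi> i = x" "\<pi> j = y"
    by (auto simp: Inc_le_def)
  then show ?R
    using Inc_gap[OF \<pi>(1), of i j] Inc_gap[OF \<pi>(1), of j n] Inc_ge[OF \<pi>(1), of i] assms
    by simp
next
  assume R: ?R
  \<comment> \<open>Translate by \<open>x - i\<close> from \<open>i\<close> on and by \<open>y - j \<ge> x - i\<close> from \<open>j\<close> on.\<close>
  define \<pi> where "\<pi> k = (if k < i then k else if k < j then k + (x - i) else k + (y - j))" for k
  have "\<pi> \<in> Inc"
    using R assms by (auto simp: Inc_def strict_mono_on_def \<pi>_def)
  moreover have "\<pi> n \<le> m" "\<pi> i = x" "\<pi> j = y"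
    using R assms by (auto simp: \<pi>_def)
  ultimately show ?L by (auto simp: Inc_le_def)
qed

lemma vertex_orbit_iff:
  assumes "1 \<le> i" "i \<le> n"
  shows "(\<exists>\<pi>\<in>Inc_le n m. \<pi> i = x) \<longleftrightarrow> i \<le> x \<and> x + n \<le> m + i" (is "?L \<longleftrightarrow> ?R")
proof
  assume ?L
  then obtain \<pi> where \<pi>: "\<pi> \<in> Inc" "\<pi> n \<le> m" "\<pi> i = x"
    by (auto simp: Inc_le_def)
  then show ?R
    using Inc_gap[OF \<pi>(1), of i n] Inc_ge[OF \<pi>(1), of i] assms
    by simp
next
  assume R: ?R
  define \<pi> where "\<pi> k = (if k < i then k else k + (x - i))" for k
  have "\<pi> \<in> Inc"
    using R assms by (auto simp: Inc_def strict_mono_on_def \<pi>_def)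
  moreover have "\<pi> n \<le> m" "\<pi> i = x"
    using R assms by (auto simp: \<pi>_def)
  ultimately show ?L by (auto simp: Inc_le_def)
qed

lemma edges_map_graph_iff:
  assumes "is_graph K" "verts K \<subseteq> {1..n}"
  shows "(x, y) \<in> edges (map_graph (Inc_le n m) K) \<longleftrightarrow>
    (\<exists>(i, j)\<in>edges K. i \<le> x \<and> j + x \<le> y + i \<and> y + n \<le> m + j)"
proof -
  have orbit: "(\<exists>\<pi>\<in>Inc_le n m. \<pi> i = x \<and> \<pi> j = y) \<longleftrightarrow> i \<le> x \<and> j + x \<le> y + i \<and> y + n \<le> m + j"
    if "(i, j) \<in> edges K" for i j
  proof (rule pair_orbit_iff)
    show "1 \<le> i" "i < j" "j \<le> n"
      using assms that by (auto simp: is_graph_def)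
  qed
  have "(x, y) \<in> edges (map_graph (Inc_le n m) K) \<longleftrightarrow>
      (\<exists>i j. (i, j) \<in> edges K \<and> (\<exists>\<pi>\<in>Inc_le n m. \<pi> i = x \<and> \<pi> j = y))"
    by (auto simp: map_graph_def)
  also have "\<dots> \<longleftrightarrow> (\<exists>i j. (i, j) \<in> edges K \<and> i \<le> x \<and> j + x \<le> y + i \<and> y + n \<le> m + j)"
    by (simp add: orbit cong: conj_cong)
  finally show ?thesis by (auto simp: Bex_def)
qed

lemma verts_map_graph_iff:
  assumes "verts K \<subseteq> {1..n}"
  shows "x \<in> verts (map_graph (Inc_le n m) K) \<longleftrightarrow> (\<exists>i\<in>verts K. i \<le> x \<and> x + n \<le> m + i)"
proof -
  have orbit: "(\<exists>\<pi>\<in>Inc_le n m. \<pi> i = x) \<longleftrightarrow> i \<le> x \<and> x + n \<le> m + i" if "i \<in> verts K" for i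
    by (rule vertex_orbit_iff) (use assms that in auto)
  have "x \<in> verts (map_graph (Inc_le n m) K) \<longleftrightarrow> (\<exists>i\<in>verts K. \<exists>\<pi>\<in>Inc_le n m. \<pi> i = x)"
    by (auto simp: map_graph_def)
  then show ?thesis by (simp add: orbit)
qed

section \<open>Stabilization\<close>

text \<open>
  For a reflexive and transitive \<open>le\<close> this is the notion of a well-quasi-order, in the form that
  Dickson's lemma provides.
\<close>

definition finite_bases :: "('a \<Rightarrow> 'a \<Rightarrow> bool) \<Rightarrow> bool" where
  "finite_bases le \<longleftrightarrow> (\<forall>A. \<exists>B\<subseteq>A. finite B \<and> (\<forall>a\<in>A. \<exists>b\<in>B. le b a))"

lemma finite_bases_nat: "finite_bases ((\<le>) :: nat \<Rightarrow> nat \<Rightarrow> bool)"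
  unfolding finite_bases_def
proof
  fix A :: "nat set"
  show "\<exists>B\<subseteq>A. finite B \<and> (\<forall>a\<in>A. \<exists>b\<in>B. b \<le> a)"
  proof (cases "A = {}")
    case False
    then have "(LEAST a. a \<in> A) \<in> A" by (meson LeastI_ex all_not_in_conv)
    then show ?thesis
      by (intro exI[of _ "{LEAST a. a \<in> A}"]) (auto intro: Least_le)
  qed auto
qed

text \<open>
  Dickson's lemma, one factor at a time. A finite basis \<open>B\<close> of the projection to the second factor
  lifts to finitely many pairs, whose first components are bounded by some \<open>N\<close>. These pairs lie below
  every element with first component at least \<open>N\<close>, and the finitely many slices below \<open>N\<close> have finite
  bases of their own.
\<close>

lemma finite_bases_prod_nat:
  assumes "finite_bases le"
  shows "finite_bases (\<lambda>(m :: nat, x) (n, y). m \<le> n \<and> le x y)"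
  unfolding finite_bases_def
proof
  fix A :: "(nat \<times> 'a) set"
  obtain B where B: "B \<subseteq> snd ` A" "finite B" "\<And>a. a \<in> snd ` A \<Longrightarrow> \<exists>b\<in>B. le b a"
    using assms unfolding finite_bases_def by meson
  then have "\<forall>b\<in>B. \<exists>n. (n, b) \<in> A" by force
  then obtain h where h: "\<And>b. b \<in> B \<Longrightarrow> (h b, b) \<in> A" by metis
  define N where "N = Max (insert 0 (h ` B))"
  have N: "h b \<le> N" if "b \<in> B" for b
    unfolding N_def using B(2) that by (intro Max_ge) auto
  have "\<forall>n. \<exists>C\<subseteq>{x. (n, x) \<in> A}. finite C \<and> (\<forall>a\<in>{x. (n, x) \<in> A}. \<exists>b\<in>C. le b a)"
    using assms unfolding finite_bases_def by blast
  then obtain C where C: "\<And>n. C n \<subseteq> {x. (n, x) \<in> A}" "\<And>n. finite (C n)"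
    "\<And>n x. (n, x) \<in> A \<Longrightarrow> \<exists>b\<in>C n. le b x"
    by (metis mem_Collect_eq)
  let ?D = "(\<lambda>b. (h b, b)) ` B \<union> (\<Union>n<N. Pair n ` C n)"
  have "?D \<subseteq> A" using h C(1) by auto
  moreover have "finite ?D" using B(2) C(2) by auto
  moreover have "\<exists>d\<in>?D. case d of (m, x) \<Rightarrow> m \<le> n \<and> le x y" if ny: "(n, y) \<in> A" for n y
  proof (cases "n < N")
    case True
    then show ?thesis using C(3)[OF ny] by auto
  next
    case False
    obtain b where "b \<in> B" "le b y" using B(3)[of y] image_eqI[of y snd "(n, y)" A] ny by auto
    then show ?thesis using N[of b] False
      by (intro bexI[of _ "(h b, b)"]) auto
  qed
  ultimately show "\<exists>D\<subseteq>A. finite D \<and>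
      (\<forall>a\<in>A. \<exists>d\<in>D. (case d of (m, x) \<Rightarrow> \<lambda>(n, y). m \<le> n \<and> le x y) a)"
    by (intro exI[of _ ?D]) (auto simp: case_prod_beta)
qed

text \<open>
  A pair \<open>(i, j) \<in> S n\<close> is the point \<open>(i, j - i, n - j)\<close> of \<open>\<nat>\<^sup>3\<close>, and \<open>n\<close> is its coordinate sum. Beyond
  the largest coordinate sum \<open>r\<close> of a finite basis, every point of level \<open>m\<close> dominates a basis
  element; moving up from that element one coordinate at a time stays below the point and passes
  through every level \<open>n\<close> between \<open>r\<close> and \<open>m\<close>.
\<close>

lemma upward_closed_family_stabilizes:
  fixes S :: "nat \<Rightarrow> (nat \<times> nat) set"
  assumes bounds: "\<And>n i j. (i, j) \<in> S n \<Longrightarrow> i \<le> j \<and> j \<le> n"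
    and closed: "\<And>n m i j x y. (i, j) \<in> S n \<Longrightarrow> i \<le> x \<Longrightarrow> j + x \<le> y + i \<Longrightarrow> y + n \<le> m + j
      \<Longrightarrow> (x, y) \<in> S m"
  shows "\<exists>r. \<forall>n\<ge>r. \<forall>m\<ge>n. \<forall>(x, y)\<in>S m. \<exists>(i, j)\<in>S n. i \<le> x \<and> j + x \<le> y + i \<and> y + n \<le> m + j"
proof -
  define A where "A = {(a, b, c). (a, a + b) \<in> S (a + b + c)}"
  have "finite_bases (\<lambda>(a :: nat, b :: nat, c :: nat) (a', b', c'). a \<le> a' \<and> b \<le> b' \<and> c \<le> c')"
    using finite_bases_prod_nat[OF finite_bases_prod_nat[OF finite_bases_nat]]
    by (simp add: case_prod_unfold)
  then obtain B where B: "B \<subseteq> A" "finite B"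
    "\<And>t. t \<in> A \<Longrightarrow> \<exists>b\<in>B. (\<lambda>(a, b, c) (a', b', c'). a \<le> a' \<and> b \<le> b' \<and> c \<le> c') b t"
    unfolding finite_bases_def by meson
  define r where "r = Max (insert 0 ((\<lambda>(a, b, c). a + b + c) ` B))"
  have r: "a + b + c \<le> r" if "(a, b, c) \<in> B" for a b c
    unfolding r_def using B(2) rev_image_eqI[OF that, of "a + b + c" "\<lambda>(a, b, c). a + b + c"]
    by (intro Max_ge) auto
  have "\<exists>(i, j)\<in>S n. i \<le> x \<and> j + x \<le> y + i \<and> y + n \<le> m + j"
    if nm: "r \<le> n" "n \<le> m" "(x, y) \<in> S m" for n m x y
  proof -
    have xy: "x \<le> y" "y \<le> m" using bounds nm(3) by auto
    have "(x, y - x, m - y) \<in> A" using nm(3) xy by (simp add: A_def)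
    then obtain a b c where abc: "(a, b, c) \<in> B" "a \<le> x" "b \<le> y - x" "c \<le> m - y"
      using B(3) by fast
    have S: "(a, a + b) \<in> S (a + b + c)" using abc(1) B(1) by (auto simp: A_def)
    have le: "a + b + c \<le> n" using r[OF abc(1)] nm(1) by simp
    \<comment> \<open>Raise the first coordinate from \<open>a\<close> towards \<open>x\<close>, then the second from \<open>b\<close> towards \<open>y - x\<close>, as far
      as the sum \<open>n\<close> permits; the third takes the rest.\<close>
    define i where "i = min x (n - b - c)"
    define j where "j = i + min (y - x) (n - i - c)"
    have "(i, j) \<in> S n"
      by (rule closed[OF S]) (use abc le in \<open>auto simp: i_def j_def\<close>)
    moreover have "i \<le> x" "j + x \<le> y + i" "y + n \<le> m + j"
      using abc le xy nm(2)
      by (cases "x \<le> n - b - c"; cases "y - x \<le> n - x - c"; simp add: i_def j_def min_def)+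
    ultimately show ?thesis by auto
  qed
  then show ?thesis by (intro exI[of _ r]) auto
qed

lemma inc_invariant_chain_stabilizes:
  assumes "inc_invariant_chain G"
  shows "\<exists>r\<ge>1. \<forall>n\<ge>r. \<forall>m\<ge>n. map_graph (Inc_le n m) (G n) = G m"
proof -
  have G: "is_graph (G n)" "verts (G n) \<subseteq> {1..n}" if "1 \<le> n" for n
    using assms that by (auto simp: inc_invariant_chain_def)
  have sub: "verts (map_graph (Inc_le n m) (G n)) \<subseteq> verts (G m)"
    "edges (map_graph (Inc_le n m) (G n)) \<subseteq> edges (G m)" if "1 \<le> n" "n \<le> m" for n m
    using assms that by (auto simp: inc_invariant_chain_def subgraph_def)
  have E: "i < j \<and> j \<le> n" if "(i, j) \<in> edges (G n)" "1 \<le> n" for i j n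
    using G[OF that(2)] that(1) by (auto simp: is_graph_def)
  define S where "S n = (if n = 0 then {} else edges (G n))" for n
  have "\<exists>r. \<forall>n\<ge>r. \<forall>m\<ge>n. \<forall>(x, y)\<in>S m. \<exists>(i, j)\<in>S n. i \<le> x \<and> j + x \<le> y + i \<and> y + n \<le> m + j"
  proof (rule upward_closed_family_stabilizes)
    show "i \<le> j \<and> j \<le> n" if "(i, j) \<in> S n" for i j n
      using E[of i j n] that by (auto simp: S_def split: if_splits)
    show "(x, y) \<in> S m"
      if *: "(i, j) \<in> S n" "i \<le> x" "j + x \<le> y + i" "y + n \<le> m + j" for i j n m x y
    proof -
      have n: "1 \<le> n" "(i, j) \<in> edges (G n)" using *(1) by (auto simp: S_def split: if_splits)
      then have "n \<le> m" using * E[of i j n] by linarith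
      have "(x, y) \<in> edges (map_graph (Inc_le n m) (G n))"
        using * n(2) by (subst edges_map_graph_iff[OF G[OF n(1)]]) auto
      then show ?thesis using sub(2)[OF n(1) \<open>n \<le> m\<close>] n \<open>n \<le> m\<close> by (auto simp: S_def)
    qed
  qed
  then obtain re where re: "\<And>n m x y. re \<le> n \<Longrightarrow> n \<le> m \<Longrightarrow> (x, y) \<in> S m \<Longrightarrow>
      \<exists>(i, j)\<in>S n. i \<le> x \<and> j + x \<le> y + i \<and> y + n \<le> m + j"
    by fast
  \<comment> \<open>A vertex \<open>i\<close> becomes the family of pairs \<open>(i, j)\<close> with arbitrary \<open>j \<ge> i\<close>: domination of pairs
    implies domination of their first components, and every vertex \<open>x\<close> of \<open>G m\<close> occurs in the
    pair \<open>(x, m)\<close>.\<close>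
  define T where "T n = {(i, j). 0 < n \<and> i \<in> verts (G n) \<and> i \<le> j \<and> j \<le> n}" for n
  have "\<exists>r. \<forall>n\<ge>r. \<forall>m\<ge>n. \<forall>(x, y)\<in>T m. \<exists>(i, j)\<in>T n. i \<le> x \<and> j + x \<le> y + i \<and> y + n \<le> m + j"
  proof (rule upward_closed_family_stabilizes)
    show "i \<le> j \<and> j \<le> n" if "(i, j) \<in> T n" for i j n
      using that by (auto simp: T_def)
    show "(x, y) \<in> T m"
      if *: "(i, j) \<in> T n" "i \<le> x" "j + x \<le> y + i" "y + n \<le> m + j" for i j n m x y
    proof -
      have n: "1 \<le> n" "i \<in> verts (G n)" "i \<le> j" "j \<le> n" using *(1) by (auto simp: T_def)
      then have m: "n \<le> m" "x \<le> y" "y \<le> m" "x + n \<le> m + i" using * by linarith+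
      have "x \<in> verts (map_graph (Inc_le n m) (G n))"
        using * n(2) m by (subst verts_map_graph_iff[OF G(2)[OF n(1)]]) auto
      then show ?thesis using sub(1)[OF n(1) m(1)] n m by (auto simp: T_def)
    qed
  qed
  then obtain rv where rv: "\<And>n m x y. rv \<le> n \<Longrightarrow> n \<le> m \<Longrightarrow> (x, y) \<in> T m \<Longrightarrow>
      \<exists>(i, j)\<in>T n. i \<le> x \<and> j + x \<le> y + i \<and> y + n \<le> m + j"
    by fast
  define r where "r = max 1 (max re rv)"
  have "map_graph (Inc_le n m) (G n) = G m" if nm: "r \<le> n" "n \<le> m" for n m
  proof -
    have n: "1 \<le> n" "re \<le> n" "rv \<le> n" using nm by (auto simp: r_def)
    have "edges (G m) \<subseteq> edges (map_graph (Inc_le n m) (G n))"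
    proof safe
      fix x y assume "(x, y) \<in> edges (G m)"
      then have "(x, y) \<in> S m" using n nm by (simp add: S_def)
      from re[OF n(2) nm(2) this] show "(x, y) \<in> edges (map_graph (Inc_le n m) (G n))"
        using n by (simp add: edges_map_graph_iff[OF G[OF n(1)]] S_def)
    qed
    moreover have "verts (G m) \<subseteq> verts (map_graph (Inc_le n m) (G n))"
    proof
      fix x assume "x \<in> verts (G m)"
      then have "(x, m) \<in> T m" using G(2)[of m] n nm by (auto simp: T_def)
      from rv[OF n(3) nm(2) this] show "x \<in> verts (map_graph (Inc_le n m) (G n))"
        by (force simp: verts_map_graph_iff[OF G(2)[OF n(1)]] T_def)
    qed
    ultimately show ?thesis using sub[OF n(1) nm(2)]
      by (intro graph.equality) auto
  qed
  then show ?thesis by (intro exI[of _ r]) (auto simp: r_def)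
qed

section \<open>Colourings as covers by independent sets\<close>

text \<open>
  Colourings are handled as covers by independent sets: covers, unlike colouring functions, can be
  restricted, united and moved piecewise, and \<open>P\<close> can be strengthened from independence to small
  diameter on part of the vertices.
\<close>

definition coverable :: "('a set \<Rightarrow> bool) \<Rightarrow> 'a set \<Rightarrow> nat \<Rightarrow> bool" where
  "coverable P U k \<longleftrightarrow> (\<exists>F. finite F \<and> card F \<le> k \<and> U \<subseteq> \<Union>F \<and> (\<forall>I\<in>F. P I))"

lemma coverableI: "finite F \<Longrightarrow> card F \<le> k \<Longrightarrow> U \<subseteq> \<Union>F \<Longrightarrow> (\<And>I. I \<in> F \<Longrightarrow> P I) \<Longrightarrow> coverable P U k"
  unfolding coverable_def by blast

lemma coverable_one: "P U \<Longrightarrow> coverable P U 1"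
  by (rule coverableI[of "{U}"]) auto

lemma coverable_Un:
  assumes "coverable P U a" "coverable P V b"
  shows "coverable P (U \<union> V) (a + b)"
proof -
  obtain E F where "finite E" "card E \<le> a" "U \<subseteq> \<Union>E" "\<forall>I\<in>E. P I"
    "finite F" "card F \<le> b" "V \<subseteq> \<Union>F" "\<forall>I\<in>F. P I"
    using assms unfolding coverable_def by blast
  then show ?thesis
    using card_Un_le[of E F] by (intro coverableI[of "E \<union> F"]) auto
qed

lemma coverable_image:
  assumes "coverable P U a" "\<And>I. P I \<Longrightarrow> Q (f ` I)"
  shows "coverable Q (f ` U) a"
proof -
  obtain F where F: "finite F" "card F \<le> a" "U \<subseteq> \<Union>F" "\<forall>I\<in>F. P I"
    using assms(1) unfolding coverable_def by blast
  have "f ` U \<subseteq> \<Union>((`) f ` F)" using image_mono[OF F(3), of f] by (simp add: image_Union)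
  then show ?thesis using F assms(2) card_image_le[OF F(1), of "(`) f"]
    by (intro coverableI[of "(`) f ` F"]) auto
qed

lemma coverable_mono:
  assumes "coverable P U a" "V \<subseteq> U" "a \<le> b" "\<And>I. P I \<Longrightarrow> Q I"
  shows "coverable Q V b"
proof -
  obtain F where "finite F" "card F \<le> a" "U \<subseteq> \<Union>F" "\<forall>I\<in>F. P I"
    using assms(1) unfolding coverable_def by blast
  then show ?thesis using assms(2-4)
    by (intro coverableI[of F]) auto
qed

definition independent_set :: "graph \<Rightarrow> nat set \<Rightarrow> bool" where
  "independent_set K I \<longleftrightarrow> (\<forall>x\<in>I. \<forall>y\<in>I. (x, y) \<notin> edges K)"

definition colourable :: "graph \<Rightarrow> nat \<Rightarrow> bool" where
  "colourable K k \<longleftrightarrow>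
     (\<exists>c :: nat \<Rightarrow> nat. c ` verts K \<subseteq> {1..k} \<and> (\<forall>(i, j) \<in> edges K. c i \<noteq> c j))"

lemma chromatic_number_eq_Least: "chromatic_number K = (LEAST k. colourable K k)"
  by (simp add: chromatic_number_def colourable_def)

lemma colourable_iff_coverable:
  assumes "is_graph K"
  shows "colourable K k \<longleftrightarrow> coverable (independent_set K) (verts K) k"
proof
  assume "colourable K k"
  then obtain c :: "nat \<Rightarrow> nat" where c: "c ` verts K \<subseteq> {1..k}" "\<forall>(i, j) \<in> edges K. c i \<noteq> c j"
    by (auto simp: colourable_def)
  have "card ((\<lambda>t. {v \<in> verts K. c v = t}) ` {1..k}) \<le> card {1..k}"
    by (rule card_image_le) simp
  then show "coverable (independent_set K) (verts K) k"
    using c by (intro coverableI[of "(\<lambda>t. {v \<in> verts K. c v = t}) ` {1..k}"])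
      (auto simp: independent_set_def)
next
  assume "coverable (independent_set K) (verts K) k"
  then obtain F where F: "finite F" "card F \<le> k" "verts K \<subseteq> \<Union>F" "\<And>I. I \<in> F \<Longrightarrow> independent_set K I"
    unfolding coverable_def by blast
  obtain h :: "nat set \<Rightarrow> nat" where h: "bij_betw h F {1..card F}"
    using F(1) finite_same_card_bij[of F "{1..card F}"] by auto
  have "\<forall>v\<in>verts K. \<exists>I\<in>F. v \<in> I" using F(3) by auto
  then obtain J where J: "\<And>v. v \<in> verts K \<Longrightarrow> J v \<in> F \<and> v \<in> J v" by metis
  have "(\<lambda>v. h (J v)) ` verts K \<subseteq> {1..k}"
  proof safe
    fix v assume "v \<in> verts K"
    then have "h (J v) \<in> {1..card F}" using J h by (auto simp: bij_betw_def)
    then show "h (J v) \<in> {1..k}" using F(2) by simp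
  qed
  moreover have "h (J x) \<noteq> h (J y)" if "(x, y) \<in> edges K" for x y
  proof
    assume eq: "h (J x) = h (J y)"
    have xy: "x \<in> verts K" "y \<in> verts K" using assms that by (auto simp: is_graph_def)
    then have "J x = J y" using eq h J by (auto simp: bij_betw_def inj_on_def)
    then show False using F(4)[of "J x"] J[OF xy(1)] J[OF xy(2)] that
      by (auto simp: independent_set_def)
  qed
  ultimately show "colourable K k"
    unfolding colourable_def by (intro exI[of _ "\<lambda>v. h (J v)"]) auto
qed

lemma colourable_card:
  assumes "is_graph K"
  shows "colourable K (card (verts K))"
proof -
  have "card ((\<lambda>v. {v}) ` verts K) \<le> card (verts K)"
    using assms by (intro card_image_le) (auto simp: is_graph_def)
  then have "coverable (independent_set K) (verts K) (card (verts K))"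
    using assms by (intro coverableI[of "(\<lambda>v. {v}) ` verts K"])
      (auto simp: is_graph_def independent_set_def)
  then show ?thesis using assms by (simp add: colourable_iff_coverable)
qed

lemma colourable_chromatic_number: "is_graph K \<Longrightarrow> colourable K (chromatic_number K)"
  unfolding chromatic_number_eq_Least by (rule LeastI, rule colourable_card)

lemma chromatic_number_le: "colourable K k \<Longrightarrow> chromatic_number K \<le> k"
  unfolding chromatic_number_eq_Least by (rule Least_le)

lemma finite_cliques: "finite (verts K) \<Longrightarrow> finite {card C | C. is_clique K C}"
  by (rule finite_subset[of _ "card ` Pow (verts K)"]) (auto simp: is_clique_def)

lemma card_clique_le: "finite (verts K) \<Longrightarrow> is_clique K C \<Longrightarrow> card C \<le> clique_number K"
  unfolding clique_number_def by (rule Max_ge) (auto simp: finite_cliques)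

lemma clique_number_le_chromatic_number:
  assumes "is_graph K"
  shows "clique_number K \<le> chromatic_number K"
proof -
  have fin: "finite (verts K)" using assms by (simp add: is_graph_def)
  obtain c :: "nat \<Rightarrow> nat" where c: "c ` verts K \<subseteq> {1..chromatic_number K}"
    "\<forall>(i, j) \<in> edges K. c i \<noteq> c j"
    using colourable_chromatic_number[OF assms] by (auto simp: colourable_def)
  have "card C \<le> chromatic_number K" if C: "is_clique K C" for C
  proof -
    have neq: "c x \<noteq> c y" if "x \<in> C" "y \<in> C" "x < y" for x y
    proof -
      have "(x, y) \<in> edges K" using C that by (auto simp: is_clique_def)
      then show ?thesis using c(2) by auto
    qed
    have "inj_on c C"
      by (rule inj_onI) (metis neq linorder_neqE_nat)
    moreover have "c ` C \<subseteq> {1..chromatic_number K}" using c(1) C by (auto simp: is_clique_def)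
    ultimately have "card C \<le> card {1..chromatic_number K}"
      by (intro card_inj_on_le) auto
    then show ?thesis by simp
  qed
  moreover have "is_clique K {}" by (simp add: is_clique_def)
  ultimately show ?thesis unfolding clique_number_def
    by (subst Max_le_iff) (auto simp: finite_cliques[OF fin])
qed

text \<open>
  With suitable \<open>P\<close> this gives the height functions of Mirsky's theorem.
\<close>

definition max_clique_card :: "graph \<Rightarrow> (nat set \<Rightarrow> bool) \<Rightarrow> nat" where
  "max_clique_card K P = Max {card C | C. is_clique K C \<and> P C}"

lemma finite_cliques_with: "finite (verts K) \<Longrightarrow> finite {card C | C. is_clique K C \<and> P C}"
  by (rule finite_subset[OF _ finite_cliques]) auto

lemma card_le_max_clique_card:
  "is_clique K C \<Longrightarrow> P C \<Longrightarrow> finite (verts K) \<Longrightarrow> card C \<le> max_clique_card K P"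
  unfolding max_clique_card_def by (rule Max_ge[OF finite_cliques_with]) auto

lemma max_clique_card_attained:
  assumes "is_clique K C" "P C" "finite (verts K)"
  obtains D where "is_clique K D" "P D" "card D = max_clique_card K P"
proof -
  let ?S = "{card C | C. is_clique K C \<and> P C}"
  have "card C \<in> ?S" using assms(1,2) by blast
  then have "Max ?S \<in> ?S" using finite_cliques_with[OF assms(3)] by (intro Max_in) auto
  then obtain D where "Max ?S = card D" "is_clique K D" "P D" by blast
  then show ?thesis using that by (simp add: max_clique_card_def)
qed

section \<open>Covers by sets of small diameter\<close>

definition narrow :: "nat \<Rightarrow> nat set \<Rightarrow> bool" where
  "narrow s I \<longleftrightarrow> (\<forall>x\<in>I. \<forall>y\<in>I. y < x + s)"

text \<open>
  The set covering the least element \<open>u\<close> contains no element of \<open>U\<close> beyond the window of length \<open>s\<close>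
  that starts at \<open>u\<close>, so it can be dropped when this window is removed.
\<close>

lemma narrow_cover_peel:
  assumes "coverable (narrow s) U k" "u \<in> U" "\<And>v. v \<in> U \<Longrightarrow> u \<le> v"
  shows "1 \<le> k \<and> coverable (narrow s) (U \<inter> {u + s..}) (k - 1)"
proof -
  obtain F where F: "finite F" "card F \<le> k" "U \<subseteq> \<Union>F" "\<And>I. I \<in> F \<Longrightarrow> narrow s I"
    using assms(1) unfolding coverable_def by blast
  obtain I where I: "I \<in> F" "u \<in> I" using F(3) assms(2) by auto
  have "v < u + s" if "v \<in> I" for v using F(4)[OF I(1)] I(2) that by (auto simp: narrow_def)
  then have "U \<inter> {u + s..} \<subseteq> \<Union>(F - {I})" using F(3) by fastforce
  moreover have "card (F - {I}) = card F - 1" using F(1) I(1) by simp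
  moreover have "1 \<le> card F" using F(1) I(1) by (metis card_0_eq empty_iff less_one not_le)
  ultimately show ?thesis using F
    by (auto intro!: coverableI[of "F - {I}"])
qed

text \<open>
  Greedy covering by windows of length \<open>s\<close>, each starting at the least uncovered element, is optimal.
  The cut \<open>u\<close> is the end of the first window that reaches beyond \<open>A\<close>.
\<close>

lemma narrow_cover_cut:
  assumes "coverable (narrow s) U k" "A \<in> U" "1 \<le> s"
  shows "\<exists>u a b. A < u \<and> u \<le> A + s \<and> a + b \<le> k \<and>
    coverable (narrow s) (U \<inter> {..<u}) a \<and> coverable (narrow s) (U \<inter> {u..}) b"
  using assms(1,2)
proof (induction k arbitrary: U)
  case 0
  then show ?case by (auto simp: coverable_def)
next
  case (Suc k)
  define m where "m = (LEAST v. v \<in> U)"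
  have m: "m \<in> U" "\<And>v. v \<in> U \<Longrightarrow> m \<le> v"
    using Suc.prems(2) by (auto simp: m_def intro: LeastI Least_le)
  have rest: "coverable (narrow s) (U \<inter> {m + s..}) k"
    using narrow_cover_peel[OF Suc.prems(1) m] by simp
  have first: "coverable (narrow s) (U \<inter> {..<m + s}) 1"
    using m(2) by (intro coverable_one) (fastforce simp: narrow_def)
  show ?case
  proof (cases "A < m + s")
    case True
    then show ?thesis using rest first m(2)[OF Suc.prems(2)]
      by (intro exI[of _ "m + s"] exI[of _ 1] exI[of _ k]) auto
  next
    case False
    then obtain u a b where u: "A < u" "u \<le> A + s" "a + b \<le> k"
      "coverable (narrow s) (U \<inter> {m + s..} \<inter> {..<u}) a"
      "coverable (narrow s) (U \<inter> {m + s..} \<inter> {u..}) b"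
      using Suc.IH[OF rest] Suc.prems(2) by auto
    have "U \<inter> {..<u} \<subseteq> (U \<inter> {..<m + s}) \<union> (U \<inter> {m + s..} \<inter> {..<u})" by auto
    then have "coverable (narrow s) (U \<inter> {..<u}) (1 + a)"
      by (rule coverable_mono[OF coverable_Un[OF first u(4)]]) auto
    moreover have "U \<inter> {m + s..} \<inter> {u..} = U \<inter> {u..}" using u(1) False by auto
    then have "coverable (narrow s) (U \<inter> {u..}) b" using u(5) by simp
    ultimately show ?thesis using u(1-3)
      by (intro exI[of _ u] exI[of _ "1 + a"] exI[of _ b]) simp
  qed
qed

section \<open>The stable graphs\<close>

text \<open>
  Here \<open>E\<close> stands for the edges of the graph at the stability index \<open>r\<close>, and \<open>H n\<close> for the graph
  at any \<open>n \<ge> r\<close>.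
\<close>

locale stable_edges =
  fixes E :: "(nat \<times> nat) set" and r s :: nat
  assumes edge_bounds: "(i, j) \<in> E \<Longrightarrow> 1 \<le> i \<and> i < j \<and> j \<le> r"
    and edge_length: "(i, j) \<in> E \<Longrightarrow> i + s \<le> j"
    and shortest_edge: "\<exists>p. (p, p + s) \<in> E"
    and edge_at_first: "\<exists>j. (1, j) \<in> E"
    and edge_at_last: "\<exists>i. (i, r) \<in> E"
begin

definition adj :: "nat \<Rightarrow> nat \<Rightarrow> nat \<Rightarrow> bool" where
  "adj n x y \<longleftrightarrow> (\<exists>(i, j)\<in>E. i \<le> x \<and> j + x \<le> y + i \<and> y + r \<le> n + j)"

definition H :: "nat \<Rightarrow> graph" where
  "H n = \<lparr> verts = {1..n}, edges = {(x, y). adj n x y} \<rparr>"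

lemma verts_H [simp]: "verts (H n) = {1..n}"
  by (simp add: H_def)

lemma edges_H [simp]: "(x, y) \<in> edges (H n) \<longleftrightarrow> adj n x y"
  by (simp add: H_def)

lemma s_pos: "1 \<le> s" and s_less_r: "s < r"
  using shortest_edge edge_bounds by fastforce+

lemma adjE:
  assumes "adj n x y"
  obtains i j where "(i, j) \<in> E" "i \<le> x" "j + x \<le> y + i" "y + r \<le> n + j"
    "1 \<le> i" "i + s \<le> j" "j \<le> r"
  using assms edge_bounds edge_length unfolding adj_def by blast

lemma adjI: "(i, j) \<in> E \<Longrightarrow> i \<le> x \<Longrightarrow> j + x \<le> y + i \<Longrightarrow> y + r \<le> n + j \<Longrightarrow> adj n x y"
  unfolding adj_def by blast

lemma adj_bounds:
  assumes "adj n x y"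
  shows "1 \<le> x" "x + s \<le> y" "y \<le> n"
  using assms by (auto elim!: adjE)

lemma is_graph_H: "is_graph (H n)"
  unfolding is_graph_def
proof (intro conjI ballI)
  show "case e of (x, y) \<Rightarrow> x \<in> verts (H n) \<and> y \<in> verts (H n) \<and> x < y"
    if "e \<in> edges (H n)" for e
    using that adj_bounds[of n "fst e" "snd e"] s_pos by (cases e) auto
qed auto

text \<open>
  The edge at the first vertex of level \<open>r\<close> makes every vertex adjacent to all sufficiently
  distant larger ones, as long as the right end is not near.
\<close>

lemma adj_far_from_last:
  assumes "1 \<le> x" "x + r \<le> y" "y + r \<le> n"
  shows "adj n x y"
proof -
  obtain j where "(1, j) \<in> E" using edge_at_first by auto
  then show ?thesis using assms edge_bounds[of 1 j] by (intro adjI[of 1 j]) auto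
qed

lemma adj_far_from_first:
  assumes "r \<le> x" "x + r \<le> y" "y \<le> n"
  shows "adj n x y"
proof -
  obtain i where "(i, r) \<in> E" using edge_at_last by auto
  then show ?thesis using assms edge_bounds[of i r] by (intro adjI[of i r]) auto
qed

lemma adj_central:
  assumes "r \<le> x" "x + s \<le> y" "y + r \<le> n"
  shows "adj n x y"
proof -
  obtain p where "(p, p + s) \<in> E" using shortest_edge by auto
  then show ?thesis using assms edge_bounds[of p "p + s"] by (intro adjI[of p "p + s"]) auto
qed

lemma narrow_imp_independent_set: "narrow s I \<Longrightarrow> independent_set (H n) I"
  unfolding narrow_def independent_set_def
  by (metis adj_bounds(2) edges_H linorder_not_less)

text \<open>
  The central vertex \<open>v\<close> is adjacent to everything at distance at least \<open>r\<close>. So \<open>I\<close> stays near \<open>v\<close>, hence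
  away from both ends, where all pairs at distance at least \<open>s\<close> are adjacent.
\<close>

lemma independent_imp_narrow:
  assumes I: "independent_set (H n) I" "I \<subseteq> {1..n}"
    and v: "v \<in> I" "2 * r \<le> v" "v + 2 * r \<le> n"
  shows "narrow s I"
proof -
  have na: "\<not> adj n x y" if "x \<in> I" "y \<in> I" for x y
    using I(1) that by (auto simp: independent_set_def)
  have near: "r \<le> w \<and> w + r \<le> n" if "w \<in> I" for w
  proof -
    have w: "1 \<le> w" "w \<le> n" using I(2) that by auto
    have "\<not> v + r \<le> w" using adj_far_from_first[of v w n] na[OF v(1) that] v w by auto
    moreover have "\<not> w + r \<le> v" using adj_far_from_last[of w v n] na[OF that v(1)] v w by auto
    ultimately show ?thesis using v by linarith
  qed
  have "y < x + s" if "x \<in> I" "y \<in> I" for x y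
    using adj_central[of x y n] near[OF that(1)] near[OF that(2)] na[OF that] by linarith
  then show ?thesis by (simp add: narrow_def)
qed

section \<open>Inserting and deleting a central window\<close>

text \<open>
  The map moves the right end by \<open>m - n\<close> and fixes the left end. For pairs on one side, the two
  relevant distances are preserved and the third is larger than \<open>r\<close>; for pairs across, the
  distances to the ends are preserved while the distance between the points is larger than \<open>r\<close>
  before and after. As no distance in \<open>E\<close> exceeds \<open>r\<close>, adjacency is unaffected.
\<close>

lemma independent_shift:
  assumes I: "independent_set (H n) I" "I \<inter> {2 * r..n - 2 * r} = {}"
    and nm: "8 * r \<le> n" "8 * r \<le> m" and u: "2 * r \<le> u" "u + 2 * r \<le> n"
  shows "independent_set (H m) ((\<lambda>v. if v < u then v else v + m - n) ` I)"
proof -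
  let ?f = "\<lambda>v. if v < u then v else v + m - n"
  have out: "w < 2 * r \<or> n < w + 2 * r" if "w \<in> I" for w
    using I(2) that by fastforce
  have reflect: "adj n x y" if xy: "x \<in> I" "y \<in> I" and a: "adj m (?f x) (?f y)" for x y
  proof -
    obtain i j where ij: "(i, j) \<in> E" "i \<le> ?f x" "j + ?f x \<le> ?f y + i" "?f y + r \<le> m + j"
      "1 \<le> i" "i + s \<le> j" "j \<le> r"
      using a by (rule adjE) blast
    show ?thesis
    proof (rule adjI[OF ij(1)])
      show "i \<le> x" "j + x \<le> y + i" "y + r \<le> n + j"
        using ij out[OF xy(1)] out[OF xy(2)] nm u by (auto split: if_splits)
    qed
  qed
  have "\<not> adj m (?f x) (?f y)" if "x \<in> I" "y \<in> I" for x y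
    using reflect[OF that] I(1) that by (auto simp: independent_set_def)
  then show ?thesis unfolding independent_set_def edges_H by blast
qed

text \<open>
  The family \<open>R\<close> consists of the classes that avoid the central zone; all others have diameter less
  than \<open>s\<close> and are replaced by sets of this kind on either side of \<open>u\<close>. The classes in \<open>R\<close> cannot be
  assigned to a side, because they may combine vertices near the left end with vertices near the
  right end.
\<close>

lemma colouring_cut:
  assumes n: "8 * r \<le> n" and k: "coverable (independent_set (H n)) {1..n} k"
  obtains u X Y R a b where "2 * r \<le> u" "u + 4 * r \<le> n" "u \<in> Y"
    "X \<subseteq> {..<u}" "Y \<subseteq> {u..}" "{1..n} \<subseteq> X \<union> Y \<union> \<Union>R"
    "coverable (narrow s) X a" "coverable (narrow s) Y b" "a + b + card R \<le> k"
    "finite R" "\<And>I. I \<in> R \<Longrightarrow> independent_set (H n) I \<and> I \<inter> {2 * r..n - 2 * r} = {}"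
proof -
  obtain F where F: "finite F" "card F \<le> k" "{1..n} \<subseteq> \<Union>F" "\<And>I. I \<in> F \<Longrightarrow> independent_set (H n) I"
    using k unfolding coverable_def by blast
  define R where "R = {I \<in> F. I \<inter> {2 * r..n - 2 * r} = {}}"
  define U where "U = \<Union>(F - R) \<inter> {1..n}"
  have "coverable (narrow s) U (card (F - R))"
  proof (rule coverableI)
    show "finite ((\<lambda>I. I \<inter> {1..n}) ` (F - R))" using F(1) by simp
    show "card ((\<lambda>I. I \<inter> {1..n}) ` (F - R)) \<le> card (F - R)"
      using F(1) by (intro card_image_le) simp
    show "U \<subseteq> \<Union>((\<lambda>I. I \<inter> {1..n}) ` (F - R))" by (auto simp: U_def)
    fix J assume "J \<in> (\<lambda>I. I \<inter> {1..n}) ` (F - R)"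
    then obtain I where I: "I \<in> F" "I \<notin> R" "J = I \<inter> {1..n}" by auto
    then obtain v where v: "v \<in> I" "2 * r \<le> v" "v \<le> n - 2 * r" by (auto simp: R_def)
    show "narrow s J"
    proof (rule independent_imp_narrow)
      show "independent_set (H n) J" using F(4)[OF I(1)] I(3) by (auto simp: independent_set_def)
      show "v \<in> J" using v I(3) n s_less_r by auto
    qed (use I v n in auto)
  qed
  moreover have central: "v \<in> U" if "2 * r \<le> v" "v \<le> n - 2 * r" for v
  proof -
    have "v \<in> {1..n}" using that n s_less_r by auto
    moreover from this obtain I where "I \<in> F" "v \<in> I" using F(3) by auto
    moreover from this have "I \<notin> R" using that by (auto simp: R_def)
    ultimately show ?thesis by (auto simp: U_def)
  qed
  moreover have "2 * r \<in> U" by (rule central) (use n in auto)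
  ultimately obtain u a b where u: "2 * r < u" "u \<le> 2 * r + s" "a + b \<le> card (F - R)"
    "coverable (narrow s) (U \<inter> {..<u}) a" "coverable (narrow s) (U \<inter> {u..}) b"
    using narrow_cover_cut[OF _ _ s_pos] by meson
  have "card (F - R) + card R = card F"
    using F(1) by (metis (no_types, lifting) R_def card_Diff_subset card_mono finite_subset
        le_add_diff_inverse2 mem_Collect_eq subsetI)
  then have card: "a + b + card R \<le> k" using u(3) F(2) by linarith
  show ?thesis
  proof (rule that[OF _ _ _ _ _ _ u(4,5) card])
    show "2 * r \<le> u" "u + 4 * r \<le> n" "u \<in> U \<inter> {u..}"
      using u n s_less_r by (auto intro!: central)
    show "{1..n} \<subseteq> U \<inter> {..<u} \<union> U \<inter> {u..} \<union> \<Union>R"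
      using F(3) by (fastforce simp: U_def)
  qed (use F in \<open>auto simp: R_def\<close>)
qed

text \<open>
  The part right of the cut moves up by \<open>s\<close>, and the gap \<open>{u..<u + s}\<close> becomes a class.
\<close>

lemma colouring_insert_window:
  assumes n: "8 * r \<le> n" and k: "coverable (independent_set (H n)) {1..n} k"
  shows "coverable (independent_set (H (n + s))) {1..n + s} (k + 1)"
proof -
  obtain u X Y R a b where u: "2 * r \<le> u" "u + 4 * r \<le> n" "u \<in> Y"
    and XY: "X \<subseteq> {..<u}" "Y \<subseteq> {u..}" "{1..n} \<subseteq> X \<union> Y \<union> \<Union>R"
    and cov: "coverable (narrow s) X a" "coverable (narrow s) Y b" and card: "a + b + card R \<le> k"
    and R: "finite R" "\<And>I. I \<in> R \<Longrightarrow> independent_set (H n) I \<and> I \<inter> {2 * r..n - 2 * r} = {}"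
    by (rule colouring_cut[OF n k]) blast
  let ?f = "\<lambda>v. if v < u then v else v + (n + s) - n"
  have "coverable (independent_set (H (n + s))) (?f ` \<Union>R) (card R)"
  proof (rule coverableI)
    show "card ((`) ?f ` R) \<le> card R" using R(1) by (rule card_image_le)
    show "independent_set (H (n + s)) J" if "J \<in> (`) ?f ` R" for J
      using that R(2) independent_shift[of n _ "n + s" u] n u by auto
  qed (use R(1) in auto)
  moreover have "coverable (independent_set (H (n + s))) (X \<union> {u..<u + s} \<union> (\<lambda>v. v + s) ` Y) (a + 1 + b)"
  proof (rule coverable_mono[OF coverable_Un[OF coverable_Un[OF cov(1) coverable_one]
          coverable_image[OF cov(2)]]])
    show "narrow s {u..<u + s}" by (auto simp: narrow_def)
    show "narrow s ((\<lambda>v. v + s) ` I)" if "narrow s I" for I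
      using that by (auto simp: narrow_def)
  qed (auto intro: narrow_imp_independent_set)
  ultimately have cover: "coverable (independent_set (H (n + s)))
      (?f ` \<Union>R \<union> (X \<union> {u..<u + s} \<union> (\<lambda>v. v + s) ` Y)) (card R + (a + 1 + b))"
    by (rule coverable_Un)
  have inside: "v \<in> ?f ` \<Union>R \<union> (X \<union> {u..<u + s} \<union> (\<lambda>v. v + s) ` Y)" if v: "v \<in> {1..n + s}" for v
  proof -
    consider "v < u" | "v \<in> {u..<u + s}" | "u + s \<le> v" by fastforce
    then show ?thesis
    proof cases
      case 1
      then have "v \<in> {1..n}" "v \<notin> Y" using v u XY(2) by auto
      then have "v \<in> X \<union> \<Union>R" using XY(3) by blast
      moreover have "v = ?f v" using 1 by simp
      ultimately show ?thesis by blast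
    next
      case 3
      then have "v - s \<in> {1..n}" "v - s \<notin> X" using v u s_less_r XY(1) by auto
      then have "v - s \<in> Y \<union> \<Union>R" using XY(3) by blast
      moreover have "v = (v - s) + s" "v = ?f (v - s)" using 3 by auto
      ultimately show ?thesis by blast
    qed auto
  qed
  show ?thesis
  proof (rule coverable_mono[OF cover])
    show "card R + (a + 1 + b) \<le> k + 1" using card by simp
  qed (use inside in blast)+
qed

text \<open>
  As \<open>u\<close> is the least element of \<open>Y\<close>, deleting the window that starts there saves a class of \<open>Y\<close>;
  then the part right of the window moves down by \<open>s\<close>.
\<close>

lemma colouring_delete_window:
  assumes n: "8 * r \<le> n" and k: "coverable (independent_set (H (n + s))) {1..n + s} k"
  shows "1 \<le> k \<and> coverable (independent_set (H n)) {1..n} (k - 1)"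
proof -
  have "8 * r \<le> n + s" using n by simp
  then obtain u X Y R a b where u: "2 * r \<le> u" "u + 4 * r \<le> n + s" "u \<in> Y"
    and XY: "X \<subseteq> {..<u}" "Y \<subseteq> {u..}" "{1..n + s} \<subseteq> X \<union> Y \<union> \<Union>R"
    and cov: "coverable (narrow s) X a" "coverable (narrow s) Y b" and card: "a + b + card R \<le> k"
    and R: "finite R"
      "\<And>I. I \<in> R \<Longrightarrow> independent_set (H (n + s)) I \<and> I \<inter> {2 * r..n + s - 2 * r} = {}"
    by (rule colouring_cut[OF _ k]) blast
  let ?f = "\<lambda>v. if v < u then v else v + n - (n + s)"
  have peel: "1 \<le> b" "coverable (narrow s) (Y \<inter> {u + s..}) (b - 1)"
    using narrow_cover_peel[OF cov(2) u(3)] XY(2) by auto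
  have "coverable (independent_set (H n)) (?f ` \<Union>R) (card R)"
  proof (rule coverableI)
    show "card ((`) ?f ` R) \<le> card R" using R(1) by (rule card_image_le)
    show "independent_set (H n) J" if "J \<in> (`) ?f ` R" for J
      using that R(2) independent_shift[of "n + s" _ n u] n u by auto
  qed (use R(1) in auto)
  moreover have "coverable (independent_set (H n)) (X \<union> (\<lambda>v. v - s) ` (Y \<inter> {u + s..})) (a + (b - 1))"
  proof (rule coverable_mono[OF coverable_Un[OF cov(1) coverable_image[OF peel(2)]]])
    show "narrow s ((\<lambda>v. v - s) ` I)" if "narrow s I" for I
      using that by (fastforce simp: narrow_def)
  qed (auto intro: narrow_imp_independent_set)
  ultimately have cover: "coverable (independent_set (H n))
      (?f ` \<Union>R \<union> (X \<union> (\<lambda>v. v - s) ` (Y \<inter> {u + s..}))) (card R + (a + (b - 1)))"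
    by (rule coverable_Un)
  have inside: "v \<in> ?f ` \<Union>R \<union> (X \<union> (\<lambda>v. v - s) ` (Y \<inter> {u + s..}))" if v: "v \<in> {1..n}" for v
  proof (cases "v < u")
    case True
    then have "v \<in> {1..n + s}" "v \<notin> Y" using v XY(2) by auto
    then have "v \<in> X \<union> \<Union>R" using XY(3) by blast
    moreover have "v = ?f v" using True by simp
    ultimately show ?thesis by blast
  next
    case False
    then have "v + s \<in> {1..n + s}" "v + s \<notin> X" "v + s \<in> {u + s..}" using v XY(1) by auto
    then have "v + s \<in> Y \<inter> {u + s..} \<union> \<Union>R" using XY(3) by blast
    moreover have "v = (v + s) - s" "v = ?f (v + s)" using False by auto
    ultimately show ?thesis by blast
  qed
  have "coverable (independent_set (H n)) {1..n} (k - 1)"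
  proof (rule coverable_mono[OF cover])
    show "card R + (a + (b - 1)) \<le> k - 1" using card peel(1) by simp
  qed (use inside in blast)+
  then show ?thesis using card peel by simp
qed

lemma chromatic_number_add_s:
  assumes "8 * r \<le> n"
  shows "chromatic_number (H (n + s)) = chromatic_number (H n) + 1"
proof (rule antisym)
  have col: "colourable (H m) k \<longleftrightarrow> coverable (independent_set (H m)) {1..m} k" for m k
    using colourable_iff_coverable[OF is_graph_H] by simp
  show "chromatic_number (H (n + s)) \<le> chromatic_number (H n) + 1"
    using colouring_insert_window[OF assms] colourable_chromatic_number[OF is_graph_H, of n]
    by (intro chromatic_number_le) (simp add: col)
  have "1 \<le> chromatic_number (H (n + s)) \<and> colourable (H n) (chromatic_number (H (n + s)) - 1)"
    using colouring_delete_window[OF assms] colourable_chromatic_number[OF is_graph_H, of "n + s"]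
    by (simp add: col)
  then show "chromatic_number (H n) + 1 \<le> chromatic_number (H (n + s))"
    using chromatic_number_le by fastforce
qed

lemma adj_mono_Suc:
  assumes "adj n x y"
  shows "adj (Suc n) x y"
proof -
  obtain i j where "(i, j) \<in> E" "i \<le> x" "j + x \<le> y + i" "y + r \<le> n + j"
    using assms by (rule adjE) blast
  then show ?thesis by (intro adjI[of i j]) auto
qed

lemma chromatic_number_mono_Suc: "chromatic_number (H n) \<le> chromatic_number (H (Suc n))"
proof (rule chromatic_number_le)
  obtain c :: "nat \<Rightarrow> nat" where c: "c ` verts (H (Suc n)) \<subseteq> {1..chromatic_number (H (Suc n))}"
    "\<forall>(x, y)\<in>edges (H (Suc n)). c x \<noteq> c y"
    using colourable_chromatic_number[OF is_graph_H, of "Suc n"] unfolding colourable_def by blast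
  have "c ` verts (H n) \<subseteq> {1..chromatic_number (H (Suc n))}"
    by (rule subset_trans[OF image_mono c(1)]) simp
  moreover have "c x \<noteq> c y" if "(x, y) \<in> edges (H n)" for x y
  proof -
    have "(x, y) \<in> edges (H (Suc n))" using that adj_mono_Suc by simp
    then show ?thesis using c(2) by blast
  qed
  ultimately show "colourable (H n) (chromatic_number (H (Suc n)))"
    unfolding colourable_def by blast
qed

section \<open>Comparison with the clique number\<close>

definition left_height :: "nat \<Rightarrow> nat \<Rightarrow> nat \<Rightarrow> nat" where
  "left_height n u x = max_clique_card (H n) (\<lambda>C. C \<subseteq> {x..<u} \<and> x \<in> C)"

definition right_height :: "nat \<Rightarrow> nat \<Rightarrow> nat \<Rightarrow> nat" where
  "right_height n u y = max_clique_card (H n) (\<lambda>C. C \<subseteq> {u..y} \<and> y \<in> C)"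

lemma left_height_ge:
  "is_clique (H n) C \<Longrightarrow> C \<subseteq> {x..<u} \<Longrightarrow> x \<in> C \<Longrightarrow> card C \<le> left_height n u x"
  unfolding left_height_def by (rule card_le_max_clique_card) simp_all

lemma right_height_ge:
  "is_clique (H n) C \<Longrightarrow> C \<subseteq> {u..y} \<Longrightarrow> y \<in> C \<Longrightarrow> card C \<le> right_height n u y"
  unfolding right_height_def by (rule card_le_max_clique_card) simp_all

lemma left_height_attained:
  assumes "x \<in> {1..n}" "x < u"
  obtains C where "is_clique (H n) C" "C \<subseteq> {x..<u}" "x \<in> C" "card C = left_height n u x"
proof -
  have "is_clique (H n) {x}" using assms by (auto simp: is_clique_def)
  moreover have "{x} \<subseteq> {x..<u} \<and> x \<in> {x}" using assms by simp
  ultimately obtain C where "is_clique (H n) C" "C \<subseteq> {x..<u} \<and> x \<in> C"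
    "card C = left_height n u x"
    unfolding left_height_def
    by (rule max_clique_card_attained[of "H n" "{x}" "\<lambda>C. C \<subseteq> {x..<u} \<and> x \<in> C"]) simp_all
  then show ?thesis using that by simp
qed

lemma right_height_attained:
  assumes "y \<in> {1..n}" "u \<le> y"
  obtains C where "is_clique (H n) C" "C \<subseteq> {u..y}" "y \<in> C" "card C = right_height n u y"
proof -
  have "is_clique (H n) {y}" using assms by (auto simp: is_clique_def)
  moreover have "{y} \<subseteq> {u..y} \<and> y \<in> {y}" using assms by simp
  ultimately obtain C where "is_clique (H n) C" "C \<subseteq> {u..y} \<and> y \<in> C"
    "card C = right_height n u y"
    unfolding right_height_def
    by (rule max_clique_card_attained[of "H n" "{y}" "\<lambda>C. C \<subseteq> {u..y} \<and> y \<in> C"]) simp_all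
  then show ?thesis using that by simp
qed

lemma clique_finite: "is_clique (H n) C \<Longrightarrow> finite C"
  by (auto simp: is_clique_def intro: finite_subset)

lemma cliqueI:
  "C \<subseteq> {1..n} \<Longrightarrow> (\<And>x y. x \<in> C \<Longrightarrow> y \<in> C \<Longrightarrow> x < y \<Longrightarrow> adj n x y) \<Longrightarrow> is_clique (H n) C"
  by (auto simp: is_clique_def)

lemma cliqueD: "is_clique (H n) C \<Longrightarrow> x \<in> C \<Longrightarrow> y \<in> C \<Longrightarrow> x < y \<Longrightarrow> adj n x y"
  by (auto simp: is_clique_def)

lemma cliqueD_verts: "is_clique (H n) C \<Longrightarrow> x \<in> C \<Longrightarrow> 1 \<le> x \<and> x \<le> n"
  by (auto simp: is_clique_def)

text \<open>
  Away from the right end only the conditions on \<open>x\<close> and on the length restrict an edge, so the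
  pair of \<open>E\<close> that witnesses \<open>x \<rightarrow> y\<close> also witnesses \<open>x \<rightarrow> z\<close>. Near the right end this
  fails in general: \<open>x\<close> and \<open>z\<close> may be too close to opposite ends at the same time.
\<close>

lemma adj_trans_left:
  assumes "adj n x y" "adj n y z" "z + r \<le> n"
  shows "adj n x z"
proof -
  obtain i j where ij: "(i, j) \<in> E" "i \<le> x" "j + x \<le> y + i"
    using assms(1) by (rule adjE) blast
  have "y \<le> z" using adj_bounds[OF assms(2)] by simp
  then show ?thesis using ij assms(3) by (intro adjI[OF ij(1)]) auto
qed

lemma adj_trans_right:
  assumes "adj n x y" "adj n y z" "r \<le> x"
  shows "adj n x z"
proof -
  obtain i j where ij: "(i, j) \<in> E" "i \<le> y" "j + y \<le> z + i" "z + r \<le> n + j" "j \<le> r" "i + s \<le> j"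
    using assms(2) by (rule adjE) blast
  have "x \<le> y" using adj_bounds[OF assms(1)] by simp
  then show ?thesis using ij assms(3) by (intro adjI[OF ij(1)]) auto
qed

text \<open>
  By transitivity, \<open>x\<close> can be added to a largest clique with minimum \<open>y\<close>.
\<close>

lemma left_height_less:
  assumes "adj n x y" "y < u" "u + r \<le> n"
  shows "left_height n u y < left_height n u x"
proof -
  have xy: "1 \<le> x" "x < y" "y \<le> n" using adj_bounds[OF assms(1)] s_pos by auto
  obtain C where C: "is_clique (H n) C" "C \<subseteq> {y..<u}" "y \<in> C" "card C = left_height n u y"
    using left_height_attained[of y n u] xy assms by auto
  have "adj n x z" if "z \<in> C" for z
  proof (cases "z = y")
    case False
    then have "adj n y z" using C(2) that by (intro cliqueD[OF C(1) C(3)]) force+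
    then show ?thesis using C(2) that assms by (intro adj_trans_left[OF assms(1)]) force+
  qed (use assms in simp)
  then have "is_clique (H n) (insert x C)"
    using C(2) xy cliqueD_verts[OF C(1)] cliqueD[OF C(1)] by (intro cliqueI) fastforce+
  then have "card (insert x C) \<le> left_height n u x"
    using C(2) xy assms by (intro left_height_ge) auto
  moreover have "x \<notin> C" using C(2) xy by auto
  ultimately show ?thesis using C(4) clique_finite[OF C(1)] by simp
qed

lemma right_height_less:
  assumes "adj n x y" "u \<le> x" "r \<le> u"
  shows "right_height n u x < right_height n u y"
proof -
  have xy: "1 \<le> x" "x < y" "y \<le> n" using adj_bounds[OF assms(1)] s_pos by auto
  obtain C where C: "is_clique (H n) C" "C \<subseteq> {u..x}" "x \<in> C" "card C = right_height n u x"
    using right_height_attained[of x n u] xy assms by auto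
  have "adj n z y" if "z \<in> C" for z
  proof (cases "z = x")
    case False
    then have "adj n z x" using C(2) that by (intro cliqueD[OF C(1) _ C(3)]) force+
    then show ?thesis using C(2) that assms by (intro adj_trans_right[OF _ assms(1)]) force+
  qed (use assms in simp)
  then have "is_clique (H n) (insert y C)"
    using C(2) xy cliqueD_verts[OF C(1)] cliqueD[OF C(1)] by (intro cliqueI) fastforce+
  then have "card (insert y C) \<le> right_height n u y"
    using C(2) xy assms by (intro right_height_ge) auto
  moreover have "y \<notin> C" using C(2) xy by auto
  ultimately show ?thesis using C(4) clique_finite[OF C(1)] by simp
qed

text \<open>
  Let \<open>C\<close> and \<open>D\<close> be the cliques that realize the two heights. A vertex of \<open>C\<close> and one of \<open>D\<close> may be
  too close to be adjacent, but only if the latter is the least element \<open>d\<close> of \<open>D\<close>: any other element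
  of \<open>D\<close> is at least \<open>d + s\<close>, and \<open>d\<close> already lies right of the cut. So \<open>C \<union> (D - {d})\<close>
  is a clique.
\<close>

lemma heights_across_le_clique_number:
  assumes a: "adj n x y" and xy: "x < u" "u \<le> y" and u: "2 * r \<le> u" "u + 2 * r \<le> n"
  shows "left_height n u x + right_height n u y \<le> clique_number (H n) + 1"
proof -
  have b: "1 \<le> x" "y \<le> n" using adj_bounds[OF a] by auto
  obtain C where C: "is_clique (H n) C" "C \<subseteq> {x..<u}" "card C = left_height n u x"
    using left_height_attained[of x n u] b xy u by auto
  obtain D where D: "is_clique (H n) D" "D \<subseteq> {u..y}" "y \<in> D" "card D = right_height n u y"
    using right_height_attained[of y n u] b xy u by auto
  define d where "d = Min D"
  have d: "d \<in> D" "\<And>w. w \<in> D \<Longrightarrow> d \<le> w"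
    using D clique_finite[OF D(1)] by (auto simp: d_def intro: Min_in)
  have across: "adj n v w" if v: "v \<in> C" and w: "w \<in> D - {d}" for v w
  proof -
    have "d < w" using d(2)[of w] w by auto
    then have "d + s \<le> w" using adj_bounds(2)[OF cliqueD[OF D(1) d(1)]] w by auto
    moreover have vw: "x \<le> v" "v < u" "u \<le> d" "w \<le> y" using C(2) D(2) v w d(1) by auto
    ultimately have len: "v + s \<le> w" by simp
    show ?thesis
    proof (cases "v + r \<le> w")
      case True
      \<comment> \<open>The edge from \<open>x\<close> to \<open>y\<close> takes care of the distances to both ends: \<open>x \<le> v\<close> and \<open>w \<le> y\<close>.\<close>
      obtain i j where "(i, j) \<in> E" "i \<le> x" "y + r \<le> n + j" "1 \<le> i" "j \<le> r"
        using a by (rule adjE) blast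
      then show ?thesis using vw True by (intro adjI[of i j]) auto
    next
      case False
      \<comment> \<open>Both vertices are within distance \<open>r\<close> of the cut, hence central.\<close>
      then show ?thesis using vw len u \<open>d < w\<close> by (intro adj_central) auto
    qed
  qed
  have "is_clique (H n) (C \<union> (D - {d}))"
  proof (rule cliqueI)
    show "C \<union> (D - {d}) \<subseteq> {1..n}" using cliqueD_verts[OF C(1)] cliqueD_verts[OF D(1)] by auto
    fix v w assume "v \<in> C \<union> (D - {d})" "w \<in> C \<union> (D - {d})" "v < w"
    moreover have "v < u" if "v \<in> C" for v using C(2) that by auto
    moreover have "u \<le> w" if "w \<in> D" for w using D(2) that by auto
    ultimately show "adj n v w"
      using cliqueD[OF C(1)] cliqueD[OF D(1)] across by (metis DiffD1 Un_iff leD less_trans)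
  qed
  then have "card (C \<union> (D - {d})) \<le> clique_number (H n)"
    by (intro card_clique_le) auto
  moreover have "C \<inter> D = {}" using C(2) D(2) by fastforce
  then have "card (C \<union> (D - {d})) = card C + (card D - 1)"
    using clique_finite[OF C(1)] clique_finite[OF D(1)] d(1)
    by (subst card_Un_disjoint) auto
  ultimately show ?thesis using C(3) D(4) by simp
qed

lemma left_height_le_clique_number: "x \<in> {1..n} \<Longrightarrow> x < u \<Longrightarrow> left_height n u x \<le> clique_number (H n)"
  by (metis card_clique_le finite_atLeastAtMost left_height_attained verts_H)

lemma right_height_le_clique_number: "y \<in> {1..n} \<Longrightarrow> u \<le> y \<Longrightarrow> right_height n u y \<le> clique_number (H n)"
  by (metis card_clique_le finite_atLeastAtMost right_height_attained verts_H)

lemma right_height_pos: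
  assumes "y \<in> {1..n}" "u \<le> y"
  shows "1 \<le> right_height n u y"
  using right_height_ge[of n "{y}" u y] assms by (simp add: is_clique_def)

lemma left_height_pos:
  assumes "x \<in> {1..n}" "x < u"
  shows "1 \<le> left_height n u x"
  using left_height_ge[of n "{x}" x u] assms by (simp add: is_clique_def)

lemma chromatic_number_le_Suc_clique_number:
  assumes n: "8 * r \<le> n"
  shows "chromatic_number (H n) \<le> clique_number (H n) + 1"
proof (rule chromatic_number_le)
  define u where "u = 2 * r"
  define w where "w = clique_number (H n)"
  have u: "2 * r \<le> u" "u + 2 * r \<le> n" using n by (auto simp: u_def)
  \<comment> \<open>Since both heights are at most \<open>w\<close>, the colours on the left are \<open>2, ..., w + 1\<close> and those on the
    right are \<open>1, ..., w\<close>. A left vertex of height \<open>a\<close> and a right one of height \<open>b\<close> share a colour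
    only if \<open>a + b = w + 2\<close>, which is too much for adjacent vertices.\<close>
  define c where "c v = (if v < u then w + 2 - left_height n u v else right_height n u v)" for v
  have "c v \<in> {1..w + 1}" if v: "v \<in> {1..n}" for v
  proof (cases "v < u")
    case True
    then show ?thesis
      using left_height_le_clique_number[OF v True] left_height_pos[OF v True] by (auto simp: c_def w_def)
  next
    case False
    then show ?thesis
      using right_height_le_clique_number[OF v, of u] right_height_pos[OF v, of u]
      by (auto simp: c_def w_def)
  qed
  moreover have "c x \<noteq> c y" if a: "adj n x y" for x y
  proof -
    have xy: "x \<in> {1..n}" "y \<in> {1..n}" "x < y" using adj_bounds[OF a] s_pos by auto
    consider "y < u" | "u \<le> x" | "x < u" "u \<le> y" by linarith
    then show ?thesis
    proof cases
      case 1
      then show ?thesis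
        using left_height_less[OF a, of u] left_height_le_clique_number[of x n u] xy u
        by (auto simp: c_def w_def)
    next
      case 2
      then show ?thesis
        using right_height_less[OF a, of u] xy u by (auto simp: c_def)
    next
      case 3
      then show ?thesis
        using heights_across_le_clique_number[OF a 3 u] by (auto simp: c_def w_def)
    qed
  qed
  ultimately show "colourable (H n) (clique_number (H n) + 1)"
    unfolding colourable_def w_def by (intro exI[of _ c]) (auto simp: image_subset_iff)
qed

end

section \<open>The eventual formula\<close>

text \<open>
  In \<open>s\<close> steps \<open>f\<close> grows by one in total, so by monotonicity it is constant except for a single jump.
  Starting at the first jump after \<open>N\<close> makes the jumps fall on the multiples of \<open>s\<close>.
\<close>

lemma quasi_linear_floor:
  fixes f :: "nat \<Rightarrow> nat"
  assumes mono: "\<And>n. f n \<le> f (Suc n)" and step: "\<And>n. N \<le> n \<Longrightarrow> f (n + s) = f n + 1"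
    and s: "1 \<le> s"
  shows "\<exists>n0>N. \<forall>n\<ge>n0. f n = f n0 + (n - n0) div s"
proof -
  have mono': "f m \<le> f n" if "m \<le> n" for m n using mono that by (rule lift_Suc_mono_le)
  define n0 where "n0 = (LEAST n. f N < f n)"
  have ex: "f N < f (N + s)" using step[of N] by simp
  have n0: "f N < f n0" "n0 \<le> N + s"
    unfolding n0_def using ex by (auto intro: LeastI Least_le)
  have gt: "N < n0" using n0(1) mono'[of n0 N] by linarith
  have "\<not> f N < f (n0 - 1)" unfolding n0_def by (rule not_less_Least) (use gt n0_def in auto)
  then have "f (n0 - 1) = f N" using mono'[of N "n0 - 1"] gt by simp
  then have last: "f (n0 - 1 + s) = f N + 1" using step[of "n0 - 1"] gt by simp
  have base: "f (n0 + t) = f n0" if "t < s" for t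
  proof -
    have "n0 + t \<le> n0 - 1 + s" using that gt by simp
    from mono'[OF this] show ?thesis using mono'[of n0 "n0 + t"] n0(1) last by simp
  qed
  have shift: "f (n0 + t + q * s) = f (n0 + t) + q" for t q
  proof (induction q)
    case (Suc q)
    then show ?case using step[of "n0 + t + q * s"] gt by (simp add: algebra_simps)
  qed simp
  have "f n = f n0 + (n - n0) div s" if "n0 \<le> n" for n
  proof -
    have "n = n0 + (n - n0) mod s + (n - n0) div s * s" using that by simp
    then have "f n = f (n0 + (n - n0) mod s) + (n - n0) div s" using shift by metis
    then show ?thesis using base[of "(n - n0) mod s"] s by simp
  qed
  then show ?thesis using gt by blast
qed

theorem theorem1p4:
  fixes G :: "nat \<Rightarrow> graph" and r s :: nat
  assumes "inc_invariant_chain G"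
    and "stability_index G = r"
    and "sparsity_index G = s"
    and "verts (G r) = {1..r}"
    and "\<exists>i\<in>{1..r}. \<exists>j\<in>{1..r}. (1, i) \<in> edges (G r) \<and> (j, r) \<in> edges (G r)"
  shows "(\<exists>n0\<ge>1. \<forall>n\<ge>n0.
            chromatic_number (G n) = chromatic_number (G n0) + (n - n0) div s) \<and>
         (\<exists>N. \<forall>n\<ge>N.
            clique_number (G n) \<le> chromatic_number (G n) \<and>
            chromatic_number (G n) \<le> clique_number (G n) + 1)"
proof -
  have "1 \<le> r \<and> (\<forall>n\<ge>r. \<forall>m\<ge>n. map_graph (Inc_le n m) (G n) = G m)"
    using LeastI_ex[OF inc_invariant_chain_stabilizes[OF assms(1), unfolded Bex_def]] assms(2)
    unfolding stability_index_def by blast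
  then have r: "1 \<le> r" "\<And>m. r \<le> m \<Longrightarrow> map_graph (Inc_le r m) (G r) = G m" by auto
  have graph: "is_graph (G r)" using assms(1) r(1) by (auto simp: inc_invariant_chain_def)
  have bounds: "1 \<le> i \<and> i < j \<and> j \<le> r" if "(i, j) \<in> edges (G r)" for i j
    using graph that assms(4) by (auto simp: is_graph_def)
  let ?L = "{j - i | i j. (i, j) \<in> edges (G r)}"
  have fin: "finite ?L"
    by (rule finite_subset[of _ "{..r}"]) (use bounds in fastforce)+
  have "s = Min ?L" using assms(2,3) by (simp add: sparsity_index_def)
  moreover have "?L \<noteq> {}" using assms(5) by auto
  ultimately have s: "s \<in> ?L" "\<And>l. l \<in> ?L \<Longrightarrow> s \<le> l"
    using fin Min_in[of ?L] by auto
  interpret stable_edges "edges (G r)" r s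
  proof
    show "1 \<le> i \<and> i < j \<and> j \<le> r" if "(i, j) \<in> edges (G r)" for i j
      using that by (rule bounds)
    show "i + s \<le> j" if "(i, j) \<in> edges (G r)" for i j
      using s(2)[of "j - i"] bounds[OF that] that by fastforce
    show "\<exists>p. (p, p + s) \<in> edges (G r)"
    proof -
      obtain i j where "(i, j) \<in> edges (G r)" "s = j - i" using s(1) by auto
      then show ?thesis using bounds[of i j] by (intro exI[of _ i]) simp
    qed
  qed (use assms(5) in auto)
  have G: "G n = H n" if "r \<le> n" for n
  proof (rule graph.equality)
    have "x \<in> verts (G n) \<longleftrightarrow> x \<in> {1..n}" for x
    proof -
      have "x \<in> verts (G n) \<longleftrightarrow> (\<exists>i\<in>{1..r}. i \<le> x \<and> x + r \<le> n + i)"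
        using verts_map_graph_iff[of "G r" r x n] r(2)[OF that] assms(4) by simp
      also have "\<dots> \<longleftrightarrow> x \<in> {1..n}"
      proof
        assume "x \<in> {1..n}"
        then show "\<exists>i\<in>{1..r}. i \<le> x \<and> x + r \<le> n + i"
          using r(1) that by (intro bexI[of _ "min x r"]) auto
      qed auto
      finally show ?thesis .
    qed
    then show "verts (G n) = verts (H n)" unfolding verts_H by blast
    have "(x, y) \<in> edges (G n) \<longleftrightarrow> adj n x y" for x y
      using edges_map_graph_iff[OF graph, of r x y n] r(2)[OF that] assms(4)
      by (simp add: adj_def)
    then show "edges (G n) = edges (H n)"
      by (intro set_eqI) (metis edges_H surj_pair)
  qed simp
  obtain n0 where n0: "n0 > 8 * r" "\<And>n. n \<ge> n0 \<Longrightarrow>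
      chromatic_number (H n) = chromatic_number (H n0) + (n - n0) div s"
    using quasi_linear_floor[of "\<lambda>n. chromatic_number (H n)", OF chromatic_number_mono_Suc
        chromatic_number_add_s s_pos] by blast
  have large: "G n = H n" if "8 * r \<le> n" for n
    by (rule G) (use that in simp)
  have "chromatic_number (G n) = chromatic_number (G n0) + (n - n0) div s" if "n0 \<le> n" for n
    unfolding large[OF less_imp_le[OF n0(1)]] large[OF order_trans[OF less_imp_le[OF n0(1)] that]]
    using that by (rule n0(2))
  moreover have "clique_number (G n) \<le> chromatic_number (G n) \<and>
      chromatic_number (G n) \<le> clique_number (G n) + 1" if "8 * r \<le> n" for n
    unfolding large[OF that]
    using clique_number_le_chromatic_number[OF is_graph_H]
      chromatic_number_le_Suc_clique_number[OF that] by blast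
  moreover have "1 \<le> n0" using n0(1) by simp
  ultimately show ?thesis by blast
qed

end
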